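(* Let $0\le\alpha<\frac{\pi}{2}$, let $A,B\in\mathcal{S}_\alpha$ be accretive $n\times n$ complex matrices, and let $f:(0,\infty)\to(0,\infty)$ be an operator monotone function with $f(1)=1$. Then $$w(f(A+B))\le\sec^3\alpha\,\bigl(w(f(A))+w(f(B))\bigr).$$
   Context: $\mathcal{M}_n$ is the algebra of complex $n\times n$ matrices. For $A\in\mathcal{M}_n$: $w(A)=\max\{|\langle Ax,x\rangle|:x\in\mathbb{C}^n,\|x\|=1\}$ is the numerical radius and $W(A)=\{\langle Ax,x\rangle:x\in\mathbb{C}^n,\|x\|=1\}$ is the numerical range. $A$ is accretive if $\Re A=\frac{A+A^*}{2}$ is positive definite. For $0\le\alpha<\pi/2$ let $S_\alpha=\{z\in\mathbb{C}:|\Im z|\le\tan\alpha\,\Re z\}$; we write $A\in\mathcal{S}_\alpha$ if $W(A)\subset S_\alpha$. A function $f:(0,\infty)\to(0,\infty)$ is operator monotone if $X\le Y$ implies $f(X)\le f(Y)$ for all positive definite matrices $X,Y$ of any size. If moreover $f(1)=1$, there is a probability measure $\nu_f$ on $[0,1]$ with $f(x)=\int_0^1((1-s)+sx^{-1})^{-1}d\nu_f(s)$ for $x>0$, and for accretive $A$ one defines $f(A)=\int_0^1((1-s)I+sA^{-1})^{-1}d\nu_f(s)$. *)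

theory Defs
  imports
    "HOL-Probability.Giry_Monad"
    "Jordan_Normal_Form.Schur_Decomposition"
    "Jordan_Normal_Form.Gauss_Jordan_Elimination"
begin

hide_type (open) Finite_Cartesian_Product.vec
hide_const (open) Finite_Cartesian_Product.vec Finite_Cartesian_Product.mat
unbundle no inner_syntax
unbundle no vec_syntax

section \<open>Numerical range and numerical radius\<close>

text \<open>The form \<open>\<langle>A x, x\<rangle>\<close>; the inner product \<open>v \<bullet>c w\<close> is conjugate linear
  in \<open>w\<close>, so \<open>\<parallel>x\<parallel> = 1\<close> reads \<open>x \<bullet>c x = 1\<close>.\<close>

definition qform :: "complex mat \<Rightarrow> complex vec \<Rightarrow> complex" where
  "qform A x = (A *\<^sub>v x) \<bullet>c x"

definition num_range :: "complex mat \<Rightarrow> complex set" where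
  "num_range A = {qform A x | x. x \<in> carrier_vec (dim_row A) \<and> x \<bullet>c x = 1}"

text \<open>For a square matrix of positive size the supremum is a maximum, see
  \<open>num_radius_attained\<close> below.\<close>

definition num_radius :: "complex mat \<Rightarrow> real" where
  "num_radius A = (SUP z \<in> num_range A. cmod z)"

lemma num_radius_attained:
  assumes A: "A \<in> carrier_mat n n" and n: "n \<ge> 1"
  shows "\<exists>z \<in> num_range A. num_radius A = cmod z \<and> (\<forall>z' \<in> num_range A. cmod z' \<le> cmod z)"
proof -
  define v where "v y = Matrix.vec n y" for y :: "nat \<Rightarrow> complex"
  define q where "q y = (\<Sum>i<n. (\<Sum>j<n. A $$ (i,j) * y j) * cnj (y i))" for y :: "nat \<Rightarrow> complex"
  define N where "N y = (\<Sum>i<n. y i * cnj (y i))" for y :: "nat \<Rightarrow> complex"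
  define P where "P = PiE UNIV (\<lambda>i. if i < n then cball (0::complex) 1 else {0})"
  define K where "K = P \<inter> {y. N y = 1}"
  have q: "qform A (v y) = q y" for y
    using A by (auto simp: qform_def q_def v_def scalar_prod_def lessThan_atLeast0 intro!: sum.cong)
  have N: "v y \<bullet>c v y = N y" for y
    by (auto simp: N_def v_def scalar_prod_def lessThan_atLeast0 intro!: sum.cong)
  have NR: "num_range A = q ` K"
  proof (intro equalityI subsetI)
    fix z assume "z \<in> num_range A"
    then obtain x where x: "x \<in> carrier_vec n" "x \<bullet>c x = 1" "z = qform A x"
      using A by (auto simp: num_range_def)
    define y where "y i = (if i < n then x $ i else 0)" for i
    have vy: "v y = x" using x by (auto simp: v_def y_def)
    have Ny: "N y = 1" using N[of y] x vy by simp
    have "N y = complex_of_real (\<Sum>i<n. (cmod (y i))\<^sup>2)"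
      unfolding N_def of_real_sum by (intro sum.cong) (auto simp: complex_norm_square simp del: of_real_power)
    hence S: "(\<Sum>i<n. (cmod (y i))\<^sup>2) = 1" using Ny by (metis of_real_eq_1_iff)
    have "cmod (y i) \<le> 1" if "i < n" for i
    proof -
      have "(cmod (y i))\<^sup>2 \<le> (\<Sum>i<n. (cmod (y i))\<^sup>2)"
        using that by (intro member_le_sum) auto
      thus ?thesis using S by (simp add: power_le_one_iff abs_square_le_1)
    qed
    hence "y \<in> K" using Ny by (auto simp: K_def P_def y_def)
    thus "z \<in> q ` K" using q[of y] vy x by auto
  next
    fix z assume "z \<in> q ` K"
    then obtain y where "y \<in> K" "z = q y" by auto
    thus "z \<in> num_range A" using q[of y] N[of y] A
      by (auto simp: num_range_def K_def v_def intro!: exI[of _ "v y"])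
  qed
  have "compactin (product_topology (\<lambda>i::nat. euclidean :: complex topology) UNIV) P"
    unfolding P_def compactin_PiE by auto
  hence "compact P" by (simp add: euclidean_product_topology)
  moreover have "closed {y. N y = 1}"
    unfolding N_def
    by (intro closed_Collect_eq continuous_intros continuous_on_product_coordinates)
  ultimately have "compact K" unfolding K_def by (rule compact_Int_closed)
  moreover have "continuous_on K (\<lambda>y. cmod (q y))"
    unfolding q_def
    by (intro continuous_intros continuous_on_subset[OF continuous_on_product_coordinates]) auto
  moreover have "K \<noteq> {}"
  proof -
    have "N (\<lambda>i. if i = 0 then 1 else 0) = (\<Sum>i<n. if i = 0 then 1 else 0)"
      unfolding N_def by (intro sum.cong) auto
    also have "\<dots> = 1" using n by (simp add: sum.delta)
    finally have "(\<lambda>i. if i = 0 then 1 else 0) \<in> K"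
      using n by (auto simp: K_def P_def)
    thus ?thesis by auto
  qed
  ultimately obtain y where y: "y \<in> K" "\<And>y'. y' \<in> K \<Longrightarrow> cmod (q y') \<le> cmod (q y)"
    using continuous_attains_sup[of K "\<lambda>y. cmod (q y)"] by blast
  have "num_radius A = cmod (q y)"
    unfolding num_radius_def NR image_image by (rule cSup_eq_maximum) (use y in auto)
  thus ?thesis using y by (auto simp: NR)
qed

definition sector :: "real \<Rightarrow> complex set" where
  "sector \<alpha> = {z. \<bar>Im z\<bar> \<le> tan \<alpha> * Re z}"

definition sectorial :: "real \<Rightarrow> complex mat \<Rightarrow> bool" where
  "sectorial \<alpha> A \<longleftrightarrow> num_range A \<subseteq> sector \<alpha>"

section \<open>Positivity\<close>

definition hermitian :: "complex mat \<Rightarrow> bool" where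
  "hermitian A \<longleftrightarrow> mat_adjoint A = A"

definition pos_semidef :: "complex mat \<Rightarrow> bool" where
  "pos_semidef A \<longleftrightarrow> hermitian A \<and> (\<forall>x \<in> carrier_vec (dim_row A). 0 \<le> Re (qform A x))"

definition pos_def :: "complex mat \<Rightarrow> bool" where
  "pos_def A \<longleftrightarrow> hermitian A \<and>
    (\<forall>x \<in> carrier_vec (dim_row A). x \<noteq> 0\<^sub>v (dim_row A) \<longrightarrow> 0 < Re (qform A x))"

definition loewner_le :: "complex mat \<Rightarrow> complex mat \<Rightarrow> bool" where
  "loewner_le X Y \<longleftrightarrow> pos_semidef (Y - X)"

definition mat_Re :: "complex mat \<Rightarrow> complex mat" where
  "mat_Re A = (1/2) \<cdot>\<^sub>m (A + mat_adjoint A)"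

definition accretive :: "complex mat \<Rightarrow> bool" where
  "accretive A \<longleftrightarrow> pos_def (mat_Re A)"

section \<open>Operator monotone functions\<close>

definition unitary :: "complex mat \<Rightarrow> bool" where
  "unitary U \<longleftrightarrow> mat_adjoint U * U = 1\<^sub>m (dim_row U) \<and> U * mat_adjoint U = 1\<^sub>m (dim_row U)"

definition spectral_comb :: "complex mat \<Rightarrow> (nat \<Rightarrow> real) \<Rightarrow> complex mat" where
  "spectral_comb U d =
    U * mat_diag (dim_row U) (\<lambda>i. complex_of_real (d i)) * mat_adjoint U"

text \<open>Functional calculus of a Hermitian matrix \<open>X\<close>: diagonalize \<open>X = U diag(d) U*\<close>
  and take \<open>U diag(f(d)) U*\<close>. The result does not depend on the diagonalization,
  see \<open>herm_fun_spectral_comb\<close> below.\<close>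

definition herm_fun :: "(real \<Rightarrow> real) \<Rightarrow> complex mat \<Rightarrow> complex mat" where
  "herm_fun f X = (SOME Y. \<exists>U d. U \<in> carrier_mat (dim_row X) (dim_row X) \<and> unitary U \<and>
     X = spectral_comb U d \<and> Y = spectral_comb U (\<lambda>i. f (d i)))"

definition operator_monotone :: "(real \<Rightarrow> real) \<Rightarrow> bool" where
  "operator_monotone f \<longleftrightarrow>
    (\<forall>n. \<forall>X \<in> carrier_mat n n. \<forall>Y \<in> carrier_mat n n.
       pos_def X \<longrightarrow> pos_def Y \<longrightarrow> loewner_le X Y \<longrightarrow>
       loewner_le (herm_fun f X) (herm_fun f Y))"

lemma mat_adjoint_carrier: "A \<in> carrier_mat n m \<Longrightarrow> mat_adjoint A \<in> carrier_mat m n"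
  by (auto simp: mat_adjoint_def)

lemma spectral_comb_cong_values:
  assumes U: "U \<in> carrier_mat n n" "unitary U" and V: "V \<in> carrier_mat n n" "unitary V"
    and eq: "spectral_comb U d = spectral_comb V e"
  shows "spectral_comb U (\<lambda>i. f (d i)) = spectral_comb V (\<lambda>i. f (e i))"
proof -
  define W where "W = mat_adjoint V * U"
  have dims [simp]: "dim_row U = n" "dim_row V = n" using U V by auto
  have c [simp]: "mat_adjoint U \<in> carrier_mat n n" "mat_adjoint V \<in> carrier_mat n n"
    "U \<in> carrier_mat n n" "V \<in> carrier_mat n n"
    by (rule mat_adjoint_carrier U(1) V(1))+
  have m [simp]: "A * B \<in> carrier_mat n n"
    if "A \<in> carrier_mat n n" "B \<in> carrier_mat n n" for A B :: "complex mat"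
    using that by (rule mult_carrier_mat)
  have W [simp]: "W \<in> carrier_mat n n" unfolding W_def by (intro m c)
  have uU: "mat_adjoint U * U = 1\<^sub>m n" "U * mat_adjoint U = 1\<^sub>m n"
    and uV: "mat_adjoint V * V = 1\<^sub>m n" "V * mat_adjoint V = 1\<^sub>m n"
    using U(2) V(2) unfolding unitary_def dims by blast+
  let ?D = "\<lambda>d. mat_diag n (\<lambda>i. complex_of_real (d i))"
  have D [simp]: "?D d \<in> carrier_mat n n" for d by (rule mat_diag_dim)
  note as = assoc_mult_mat[of _ n n _ n _ n]
  have move: "mat_adjoint V * (spectral_comb U d * U) = W * ?D d"
    "mat_adjoint V * (spectral_comb V e * U) = ?D e * W" for d e
  proof -
    have "spectral_comb U d * U = U * ?D d * (mat_adjoint U * U)"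
      unfolding spectral_comb_def dims by (intro as m c D)
    also have "\<dots> = U * ?D d" unfolding uU by (intro right_mult_one_mat[of _ n n] m c D)
    finally have "mat_adjoint V * (spectral_comb U d * U) = mat_adjoint V * (U * ?D d)" by simp
    also have "\<dots> = W * ?D d" unfolding W_def by (intro as[symmetric] m c D)
    finally show "mat_adjoint V * (spectral_comb U d * U) = W * ?D d" .
    have "spectral_comb V e * U = V * ?D e * W"
      unfolding spectral_comb_def dims W_def by (intro as m c D)
    also have "\<dots> = V * (?D e * W)" by (intro as m c D W)
    finally have "mat_adjoint V * (spectral_comb V e * U) = mat_adjoint V * (V * (?D e * W))"
      by simp
    also have "\<dots> = mat_adjoint V * V * (?D e * W)" by (intro as[symmetric] m c D W)
    also have "\<dots> = ?D e * W" unfolding uV by (intro left_mult_one_mat[of _ n n] m D W)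
    finally show "mat_adjoint V * (spectral_comb V e * U) = ?D e * W" .
  qed
  have WD: "W * ?D d = ?D e * W" using move eq by metis
  have ent: "W $$ (i,j) * complex_of_real (d j) = complex_of_real (e i) * W $$ (i,j)"
    if "i < n" "j < n" for i j
  proof -
    have "(W * ?D d) $$ (i,j) = (?D e * W) $$ (i,j)" by (simp add: WD)
    thus ?thesis using that by (simp add: mat_diag_mult_left[OF W] mat_diag_mult_right[OF W])
  qed
  have "W * ?D (\<lambda>i. f (d i)) = ?D (\<lambda>i. f (e i)) * W"
    unfolding mat_diag_mult_left[OF W] mat_diag_mult_right[OF W]
  proof (rule eq_matI, goal_cases)
    case (1 i j)
    then show ?case using ent[of i j] by (cases "W $$ (i,j) = 0") (auto simp: mult.commute)
  qed auto
  hence *: "mat_adjoint V * (spectral_comb U (\<lambda>i. f (d i)) * U)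
      = mat_adjoint V * (spectral_comb V (\<lambda>i. f (e i)) * U)"
    by (simp add: move)
  have sc: "spectral_comb U d \<in> carrier_mat n n" "spectral_comb V d \<in> carrier_mat n n" for d
    unfolding spectral_comb_def dims by (intro m c D)+
  have cancel: "V * (mat_adjoint V * (S * U)) * mat_adjoint U = S" if S: "S \<in> carrier_mat n n" for S
  proof -
    have "V * (mat_adjoint V * (S * U)) = (V * mat_adjoint V) * (S * U)"
      by (intro as[symmetric] m c S)
    also have "\<dots> = S * U"
      unfolding uV by (intro left_mult_one_mat[of _ n n] m c S)
    also have "S * U * mat_adjoint U = S * (U * mat_adjoint U)"
      by (intro as m c S)
    also have "\<dots> = S" unfolding uU by (intro right_mult_one_mat[of _ n n] S)
    finally show ?thesis .
  qed
  show ?thesis using * cancel[OF sc(1)] cancel[OF sc(2)] by metis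
qed

lemma herm_fun_spectral_comb:
  assumes "U \<in> carrier_mat n n" "unitary U"
  shows "herm_fun f (spectral_comb U d) = spectral_comb U (\<lambda>i. f (d i))"
proof -
  have n: "dim_row (spectral_comb U d) = n" using assms by (auto simp: spectral_comb_def)
  show ?thesis
    unfolding herm_fun_def n
  proof (rule some_equality)
    show "\<exists>V e. V \<in> carrier_mat n n \<and> unitary V \<and> spectral_comb U d = spectral_comb V e \<and>
        spectral_comb U (\<lambda>i. f (d i)) = spectral_comb V (\<lambda>i. f (e i))"
      by (rule exI[of _ U], rule exI[of _ d]) (simp add: assms)
  next
    fix Y
    assume "\<exists>V e. V \<in> carrier_mat n n \<and> unitary V \<and> spectral_comb U d = spectral_comb V e \<and>
        Y = spectral_comb V (\<lambda>i. f (e i))"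
    then obtain V e where V: "V \<in> carrier_mat n n" "unitary V"
      "spectral_comb U d = spectral_comb V e" and Y: "Y = spectral_comb V (\<lambda>i. f (e i))"
      by (elim exE conjE)
    show "Y = spectral_comb U (\<lambda>i. f (d i))"
      unfolding Y by (rule spectral_comb_cong_values[OF assms V, symmetric])
  qed
qed

section \<open>Functional calculus of accretive matrices\<close>

definition represents :: "real measure \<Rightarrow> (real \<Rightarrow> real) \<Rightarrow> bool" where
  "represents \<nu> f \<longleftrightarrow>
    prob_space \<nu> \<and> sets \<nu> = sets (restrict_space borel {0..1}) \<and>
    (\<forall>x>0. f x = (\<integral>s. inverse ((1 - s) + s * inverse x) \<partial>\<nu>))"

text \<open>By Loewner's theorem, every operator monotone \<open>f\<close> from the positive reals to themselves
  with \<open>f 1 = 1\<close> has exactly one representing measure, which is then \<open>rep_measure f\<close>.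
  The other branch is never reached for such \<open>f\<close> and only makes the definition total.\<close>

definition rep_measure :: "(real \<Rightarrow> real) \<Rightarrow> real measure" where
  "rep_measure f =
    (if \<exists>\<nu>. represents \<nu> f then SOME \<nu>. represents \<nu> f
     else return (restrict_space borel {0..1}) 1)"

definition mat_inv :: "complex mat \<Rightarrow> complex mat" where
  "mat_inv A = the (mat_inverse A)"

definition resolvent_kernel :: "complex mat \<Rightarrow> real \<Rightarrow> complex mat" where
  "resolvent_kernel A s =
    mat_inv (complex_of_real (1 - s) \<cdot>\<^sub>m 1\<^sub>m (dim_row A) + complex_of_real s \<cdot>\<^sub>m mat_inv A)"

text \<open>The matrix-valued integral is taken entrywise.\<close>

definition mat_fun :: "(real \<Rightarrow> real) \<Rightarrow> complex mat \<Rightarrow> complex mat" where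
  "mat_fun f A = Matrix.mat (dim_row A) (dim_row A)
     (\<lambda>(i, j). \<integral>s. resolvent_kernel A s $$ (i, j) \<partial>(rep_measure f))"

end

theory Submission
  imports Defs
begin

text \<open>Write \<open>T\<^sub>s(A) = ((1-s) + s A\<^sup>-\<^sup>1)\<^sup>-\<^sup>1\<close> and \<open>f\<^sub>s(c) = c / ((1-s) c + s)\<close>, and let \<open>a\<close>, \<open>b\<close> be the
  largest eigenvalues of \<open>Re A\<close>, \<open>Re B\<close>. At a unit eigenvector \<open>x\<close> of \<open>Re A\<close> for \<open>a\<close> one has
  \<open>Re \<langle>T\<^sub>s(A) x, x\<rangle> \<ge> f\<^sub>s(a)\<close>, so the radius of \<open>f(A)\<close> is at least \<open>\<integral> f\<^sub>s(a)\<close>, and likewise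
  for \<open>B\<close>. Conversely \<open>Re (A + B) \<le> a + b\<close> gives \<open>|\<langle>T\<^sub>s(A+B) x, x\<rangle>| \<le> sec\<^sup>3 \<alpha> f\<^sub>s(a+b)\<close> for
  every unit \<open>x\<close>: one factor \<open>sec \<alpha>\<close> bounds the modulus by the real part, and the others come from
  \<open>\<parallel>C z\<parallel>\<^sup>2 \<le> sec\<^sup>2 \<alpha> (a+b) Re \<langle>C z, z\<rangle>\<close> for \<open>C = A + B\<close>. Each \<open>f\<^sub>s\<close> is subadditive, and integration
  over \<open>s\<close> concludes.\<close>

section \<open>Forms of accretive and sectorial matrices\<close>

lemma cscalar_add_left:
  fixes u v w :: "complex vec"
  assumes "u \<in> carrier_vec n" "v \<in> carrier_vec n" "w \<in> carrier_vec n"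
  shows "(u + v) \<bullet>c w = u \<bullet>c w + v \<bullet>c w"
  using assms by (simp add: add_scalar_prod_distrib[of _ n])

lemma cscalar_add_right:
  fixes u v w :: "complex vec"
  assumes "u \<in> carrier_vec n" "v \<in> carrier_vec n" "w \<in> carrier_vec n"
  shows "u \<bullet>c (v + w) = u \<bullet>c v + u \<bullet>c w"
  using assms by (simp add: conjugate_add_vec[of _ n] scalar_prod_add_distrib[of _ n])

lemma cscalar_smult_left:
  fixes u v :: "complex vec"
  assumes "u \<in> carrier_vec n" "v \<in> carrier_vec n"
  shows "(c \<cdot>\<^sub>v u) \<bullet>c v = c * (u \<bullet>c v)"
  using assms by (simp add: smult_scalar_prod_distrib[of _ n])

lemma cscalar_smult_right:
  fixes u v :: "complex vec"
  assumes "u \<in> carrier_vec n" "v \<in> carrier_vec n"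
  shows "u \<bullet>c (c \<cdot>\<^sub>v v) = cnj c * (u \<bullet>c v)"
  using assms by (simp add: conjugate_smult_vec scalar_prod_smult_distrib[of _ n])

lemma cscalar_commute:
  fixes u v :: "complex vec"
  assumes "u \<in> carrier_vec n" "v \<in> carrier_vec n"
  shows "v \<bullet>c u = cnj (u \<bullet>c v)"
  using assms by (auto simp: scalar_prod_def intro!: sum.cong)

lemma cscalar_self:
  fixes u :: "complex vec"
  shows "u \<bullet>c u = complex_of_real (Re (u \<bullet>c u))" "0 \<le> Re (u \<bullet>c u)"
proof -
  have "0 \<le> u \<bullet>c u" by (rule conjugate_square_ge_0_vec)
  then show "u \<bullet>c u = complex_of_real (Re (u \<bullet>c u))" "0 \<le> Re (u \<bullet>c u)"
    by (auto simp: less_eq_complex_def complex_eq_iff)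
qed

lemma cscalar_self_pos:
  fixes u :: "complex vec"
  assumes "u \<in> carrier_vec n" "u \<noteq> 0\<^sub>v n"
  shows "0 < Re (u \<bullet>c u)"
proof -
  have "u \<bullet>c u \<noteq> 0" using assms by simp
  then show ?thesis using cscalar_self[of u] by (metis less_eq_real_def of_real_0)
qed

text \<open>\<open>num_range\<close> sees only unit vectors; this carries its bounds over to all
  nonzero vectors.\<close>

lemma normalize_vec:
  fixes x :: "complex vec"
  assumes x: "x \<in> carrier_vec n" "x \<noteq> 0\<^sub>v n"
  obtains u r where "u \<in> carrier_vec n" "u \<bullet>c u = 1" "0 < r" "x = complex_of_real r \<cdot>\<^sub>v u"
proof -
  define r where "r = sqrt (Re (x \<bullet>c x))"
  have r: "0 < r" "r * r = Re (x \<bullet>c x)" using cscalar_self_pos[OF x] by (auto simp: r_def)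
  define u where "u = complex_of_real (1 / r) \<cdot>\<^sub>v x"
  have u: "u \<in> carrier_vec n" using x by (simp add: u_def)
  have "x \<bullet>c x = complex_of_real (r * r)" using cscalar_self(1)[of x] r(2) by simp
  then have "u \<bullet>c u = 1"
    using x r(1) by (simp add: u_def cscalar_smult_left[of _ n] cscalar_smult_right[of _ n])
  moreover have "x = complex_of_real r \<cdot>\<^sub>v u" using r(1) by (simp add: u_def smult_smult_assoc)
  ultimately show thesis using that u r(1) by blast
qed

section \<open>Quadratic forms and real parts of matrices\<close>

lemma smult_mat_mult_vec:
  fixes A :: "complex mat"
  assumes "A \<in> carrier_mat n n" "x \<in> carrier_vec n"
  shows "(c \<cdot>\<^sub>m A) *\<^sub>v x = c \<cdot>\<^sub>v (A *\<^sub>v x)"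
  using assms by (intro eq_vecI) auto

lemma qform_smult_vec:
  assumes "A \<in> carrier_mat n n" "x \<in> carrier_vec n"
  shows "qform A (complex_of_real r \<cdot>\<^sub>v x) = complex_of_real (r\<^sup>2) * qform A x"
  using assms
  by (simp add: qform_def mult_mat_vec[of _ n n] cscalar_smult_left[of _ n]
      cscalar_smult_right[of _ n] power2_eq_square)

lemma qform_smult_mat:
  assumes "A \<in> carrier_mat n n" "x \<in> carrier_vec n"
  shows "qform (c \<cdot>\<^sub>m A) x = c * qform A x"
  using assms by (simp add: qform_def smult_mat_mult_vec[of _ n] cscalar_smult_left[of _ n])

lemma qform_add_mat:
  assumes "A \<in> carrier_mat n n" "B \<in> carrier_mat n n" "x \<in> carrier_vec n"
  shows "qform (A + B) x = qform A x + qform B x"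
  using assms by (simp add: qform_def add_mult_distrib_mat_vec[of _ n n] cscalar_add_left[of _ n])

lemma mat_adjoint_index:
  assumes "A \<in> carrier_mat n n" "i < n" "j < n"
  shows "mat_adjoint A $$ (i, j) = cnj (A $$ (j, i))"
  using assms by (auto simp: mat_adjoint_def mat_of_rows_def)

lemma qform_mat_adjoint:
  assumes A: "A \<in> carrier_mat n n" and x: "x \<in> carrier_vec n"
  shows "qform (mat_adjoint A) x = cnj (qform A x)"
proof -
  have "qform (mat_adjoint A) x = (\<Sum>i<n. \<Sum>j<n. cnj (A $$ (j, i)) * x $ j * cnj (x $ i))"
    using A x mat_adjoint_carrier[OF A]
    by (auto simp: qform_def scalar_prod_def lessThan_atLeast0 sum_distrib_right mat_adjoint_index[OF A] intro!: sum.cong)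
  also have "\<dots> = (\<Sum>j<n. \<Sum>i<n. cnj (A $$ (j, i)) * x $ j * cnj (x $ i))" by (rule sum.swap)
  also have "\<dots> = cnj (qform A x)"
    using A x
    by (auto simp: qform_def scalar_prod_def lessThan_atLeast0 sum_distrib_right intro!: sum.cong)
  finally show ?thesis .
qed

lemma qform_mat_Re:
  assumes "A \<in> carrier_mat n n" "x \<in> carrier_vec n"
  shows "qform (mat_Re A) x = complex_of_real (Re (qform A x))"
  using assms mat_adjoint_carrier[OF assms(1)]
  by (simp add: mat_Re_def qform_smult_mat[of _ n] qform_add_mat[of _ n] qform_mat_adjoint[of _ n]
      complex_add_cnj)

lemma mat_Re_carrier: "A \<in> carrier_mat n n \<Longrightarrow> mat_Re A \<in> carrier_mat n n"
  by (simp add: mat_Re_def mat_adjoint_carrier)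

lemma accretive_qform_pos:
  assumes "A \<in> carrier_mat n n" "accretive A" "x \<in> carrier_vec n" "x \<noteq> 0\<^sub>v n"
  shows "0 < Re (qform A x)"
  using assms mat_Re_carrier[OF assms(1)] by (auto simp: accretive_def pos_def_def qform_mat_Re)

lemma hermitian_mat_Re:
  assumes A: "A \<in> carrier_mat n n"
  shows "hermitian (mat_Re A)"
  unfolding hermitian_def
proof (rule eq_matI)
  note R = mat_Re_carrier[OF A] and R' = mat_adjoint_carrier[OF mat_Re_carrier[OF A]]
  show "dim_row (mat_adjoint (mat_Re A)) = dim_row (mat_Re A)"
    "dim_col (mat_adjoint (mat_Re A)) = dim_col (mat_Re A)" using R R' by auto
  show "mat_adjoint (mat_Re A) $$ (i, j) = mat_Re A $$ (i, j)"
    if "i < dim_row (mat_Re A)" "j < dim_col (mat_Re A)" for i j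
  proof -
    have ij: "i < n" "j < n" using R that by auto
    have "mat_adjoint (mat_Re A) $$ (i, j) = cnj (mat_Re A $$ (j, i))"
      by (rule mat_adjoint_index[OF R ij])
    also have "\<dots> = mat_Re A $$ (i, j)"
      using A ij mat_adjoint_carrier[OF A] by (auto simp: mat_Re_def mat_adjoint_index[OF A])
    finally show ?thesis .
  qed
qed

lemma accretiveI:
  assumes A: "A \<in> carrier_mat n n"
    and pos: "\<And>x. x \<in> carrier_vec n \<Longrightarrow> x \<noteq> 0\<^sub>v n \<Longrightarrow> 0 < Re (qform A x)"
  shows "accretive A"
  using mat_Re_carrier[OF A] hermitian_mat_Re[OF A] pos
  by (auto simp: accretive_def pos_def_def qform_mat_Re[OF A])

text \<open>The sector is a cone and the form scales by a positive square, so the condition on unit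
  vectors extends to every vector.\<close>

lemma sectorial_qform:
  assumes A: "A \<in> carrier_mat n n" and S: "sectorial \<alpha> A" and x: "x \<in> carrier_vec n"
  shows "\<bar>Im (qform A x)\<bar> \<le> tan \<alpha> * Re (qform A x)"
proof (cases "x = 0\<^sub>v n")
  case True
  then have "qform A x = 0" using A by (simp add: qform_def)
  then show ?thesis by simp
next
  case False
  then obtain u r where u: "u \<in> carrier_vec n" "u \<bullet>c u = 1" "0 < r" "x = complex_of_real r \<cdot>\<^sub>v u"
    using normalize_vec[OF x] by blast
  have "qform A u \<in> num_range A" using A u by (auto simp: num_range_def)
  then have "\<bar>Im (qform A u)\<bar> \<le> tan \<alpha> * Re (qform A u)"
    using S by (auto simp: sectorial_def sector_def)
  then have "r\<^sup>2 * \<bar>Im (qform A u)\<bar> \<le> r\<^sup>2 * (tan \<alpha> * Re (qform A u))"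
    by (rule mult_left_mono) simp
  then show ?thesis using u A by (simp add: qform_smult_vec[of _ n] abs_mult mult_ac flip: of_real_power)
qed

lemma qform_le_by_unit:
  assumes A: "A \<in> carrier_mat n n" and x: "x \<in> carrier_vec n"
    and le: "\<And>u. u \<in> carrier_vec n \<Longrightarrow> u \<bullet>c u = 1 \<Longrightarrow> Re (qform A u) \<le> c"
  shows "Re (qform A x) \<le> c * Re (x \<bullet>c x)"
proof (cases "x = 0\<^sub>v n")
  case True
  then show ?thesis using A by (simp add: qform_def)
next
  case False
  then obtain u r where u: "u \<in> carrier_vec n" "u \<bullet>c u = 1" "0 < r" "x = complex_of_real r \<cdot>\<^sub>v u"
    using normalize_vec[OF x] by blast
  have "x \<bullet>c x = complex_of_real (r * r)"
    using u by (simp add: cscalar_smult_left[of _ n] cscalar_smult_right[of _ n])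
  moreover have "r\<^sup>2 * Re (qform A u) \<le> r\<^sup>2 * c"
    using le[OF u(1,2)] by (intro mult_left_mono) auto
  ultimately show ?thesis
    using u A by (simp add: qform_smult_vec[of _ n] power2_eq_square mult_ac flip: of_real_power)
qed

text \<open>Cauchy--Schwarz for the semidefinite Hermitian form \<open>\<langle>(E + E*) z, w\<rangle>\<close>.\<close>

lemma qform_cauchy_schwarz:
  assumes E: "E \<in> carrier_mat n n" and pos: "\<And>v. v \<in> carrier_vec n \<Longrightarrow> 0 \<le> Re (qform E v)"
    and z: "z \<in> carrier_vec n" and w: "w \<in> carrier_vec n"
  shows "(cmod ((E *\<^sub>v z) \<bullet>c w + cnj ((E *\<^sub>v w) \<bullet>c z)))\<^sup>2
    \<le> 4 * Re (qform E z) * Re (qform E w)"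
proof -
  define b where "b = (E *\<^sub>v z) \<bullet>c w + cnj ((E *\<^sub>v w) \<bullet>c z)"
  define p where "p = Re (qform E z)"
  define q where "q = Re (qform E w)"
  define D where "D = (cmod b)\<^sup>2"
  have Ez: "E *\<^sub>v z \<in> carrier_vec n" "E *\<^sub>v w \<in> carrier_vec n" using E z w by auto
  \<comment> \<open>Testing positivity at \<open>z + c w\<close> with \<open>c = - r b\<close>
    aligns the phases: the mixed term becomes \<open>- r * D\<close>, and a real quadratic in
    \<open>r\<close> remains.\<close>
  have key: "0 \<le> p - r * D + r\<^sup>2 * D * q" for r :: real
  proof -
    define c where "c = - complex_of_real r * b"
    have cw: "c \<cdot>\<^sub>v w \<in> carrier_vec n" using w by simp
    have "qform E (z + c \<cdot>\<^sub>v w) = qform E z + cnj c * ((E *\<^sub>v z) \<bullet>c w)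
        + c * ((E *\<^sub>v w) \<bullet>c z) + c * cnj c * qform E w"
      using E z w Ez cw
      by (simp add: qform_def mult_add_distrib_mat_vec[of _ n n] mult_mat_vec[of _ n n]
          cscalar_add_left[of _ n] cscalar_add_right[of _ n] cscalar_smult_left[of _ n]
          cscalar_smult_right[of _ n] algebra_simps)
    moreover have "Re (cnj c * ((E *\<^sub>v z) \<bullet>c w) + c * ((E *\<^sub>v w) \<bullet>c z)) = Re (cnj c * b)"
      by (simp add: b_def algebra_simps)
    ultimately have "Re (qform E (z + c \<cdot>\<^sub>v w)) = p + Re (cnj c * b) + Re (c * cnj c * qform E w)"
      by (simp add: p_def)
    moreover have "cnj c * b = complex_of_real (- r * D)"
      by (simp add: c_def D_def complex_norm_square mult_ac del: of_real_power)
    moreover have "c * cnj c = complex_of_real (r\<^sup>2 * D)"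
      by (simp add: c_def D_def complex_norm_square power2_eq_square[of r] mult_ac del: of_real_power)
    ultimately have "Re (qform E (z + c \<cdot>\<^sub>v w)) = p - r * D + r\<^sup>2 * D * q"
      by (simp add: q_def)
    then show ?thesis using pos[of "z + c \<cdot>\<^sub>v w"] z cw by simp
  qed
  have pq: "0 \<le> p" "0 \<le> q" using pos z w by (auto simp: p_def q_def)
  have D0: "0 \<le> D" by (simp add: D_def)
  have "D \<le> 4 * p * q"
  proof (cases "q = 0")
    case True
    \<comment> \<open>Without the quadratic term, this value of \<open>r\<close> would make the form
      equal to \<open>-1\<close>, unless \<open>D = 0\<close>.\<close>
    then show ?thesis using key[of "(p + 1) / D"] D0 by (cases "D = 0") auto
  next
    case False
    then have "0 < q" using pq by simp
    \<comment> \<open>The quadratic attains its minimum at \<open>r = 1 / (2 * q)\<close>, with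
      value \<open>p - D / (4 * q)\<close>.\<close>
    moreover have "0 \<le> p - (1 / (2 * q)) * D + (1 / (2 * q))\<^sup>2 * D * q" by (rule key)
    moreover have "(1 / (2 * q))\<^sup>2 * D * q = D / (4 * q)"
      using False by (simp add: power2_eq_square field_simps)
    moreover have "(1 / (2 * q)) * D = 2 * (D / (4 * q))"
      using False by (simp add: field_simps)
    ultimately have "D / (4 * q) \<le> p" by linarith
    then show ?thesis using \<open>0 < q\<close> by (simp add: field_simps)
  qed
  then show ?thesis by (simp add: D_def b_def p_def q_def)
qed

text \<open>The forms of \<open>(t - i) A\<close> and \<open>(t + i) A\<close> have nonnegative real part; \<open>\<langle>A z, w\<rangle>\<close> is a
  combination of the two associated Hermitian forms, unless \<open>t = 0\<close>.\<close>

lemma sectorial_cauchy_schwarz: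
  assumes A: "A \<in> carrier_mat n n" and t: "0 \<le> t"
    and sec: "\<And>v. v \<in> carrier_vec n \<Longrightarrow> \<bar>Im (qform A v)\<bar> \<le> t * Re (qform A v)"
    and pos: "\<And>v. v \<in> carrier_vec n \<Longrightarrow> 0 \<le> Re (qform A v)"
    and z: "z \<in> carrier_vec n" and w: "w \<in> carrier_vec n"
  shows "(cmod ((A *\<^sub>v z) \<bullet>c w))\<^sup>2 \<le> (1 + t\<^sup>2) * Re (qform A z) * Re (qform A w)"
proof -
  define b where "b = (A *\<^sub>v z) \<bullet>c w"
  define b' where "b' = cnj ((A *\<^sub>v w) \<bullet>c z)"
  have CS: "(cmod (c * b + cnj c * b'))\<^sup>2 \<le> 4 * Re (c * qform A z) * Re (c * qform A w)"
    if c: "\<And>v. v \<in> carrier_vec n \<Longrightarrow> 0 \<le> Re (c * qform A v)" for c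
  proof -
    have "c \<cdot>\<^sub>m A \<in> carrier_mat n n" using A by simp
    from qform_cauchy_schwarz[OF this _ z w] c show ?thesis
      using A z w
      by (simp add: qform_smult_mat[of _ n] smult_mat_mult_vec[of _ n] cscalar_smult_left[of _ n]
          b_def b'_def)
  qed
  \<comment> \<open>With \<open>h = qform A v\<close> the two values are
    \<open>t * Re h + Im h\<close> and \<open>t * Re h - Im h\<close>. Their nonnegativity is the
    sector condition, and in their sum the imaginary parts cancel.\<close>
  define e where "e v = Re (Complex t (-1) * qform A v)" for v
  define g where "g v = Re (Complex t 1 * qform A v)" for v
  have pos_eg: "0 \<le> e v" "0 \<le> g v" if "v \<in> carrier_vec n" for v
    using sec[OF that] by (auto simp: e_def g_def)
  have eg: "e v + g v = 2 * t * Re (qform A v)" for v by (simp add: e_def g_def)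
  define \<beta> where "\<beta> = Complex t (-1) * b + Complex t 1 * b'"
  define \<gamma> where "\<gamma> = Complex t 1 * b + Complex t (-1) * b'"
  have \<beta>: "(cmod \<beta>)\<^sup>2 \<le> 4 * e z * e w"
    using CS[of "Complex t (-1)"] pos_eg(1) by (simp add: \<beta>_def e_def complex_cnj)
  have \<gamma>: "(cmod \<gamma>)\<^sup>2 \<le> 4 * g z * g w"
    using CS[of "Complex t 1"] pos_eg(2) by (simp add: \<gamma>_def g_def complex_cnj)
  show ?thesis
  proof (cases "t = 0")
    case True
    \<comment> \<open>For \<open>t = 0\<close> the two Hermitian forms are proportional, so
      \<open>b'\<close> cannot be eliminated between them. Instead both vanish, which forces
      \<open>b' = b\<close>, and the multiplier 1 gives the bound.\<close>
    then have "e z = 0" using pos_eg[OF z] eg[of z] by simp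
    then have "\<beta> = 0" using \<beta> by simp
    then have "b' = b" by (simp add: \<beta>_def True complex_eq_iff)
    moreover have "(cmod (1 * b + cnj 1 * b'))\<^sup>2 \<le> 4 * Re (1 * qform A z) * Re (1 * qform A w)"
      by (rule CS) (use pos in simp)
    ultimately have "(cmod (2 * b))\<^sup>2 \<le> 4 * Re (qform A z) * Re (qform A w)" by simp
    then show ?thesis by (simp add: True b_def norm_mult power_mult_distrib)
  next
    case False
    then have t: "0 < t" using t by simp
    \<comment> \<open>This combination removes \<open>b'\<close>, whose coefficient is
      \<open>t\<^sup>2 + 1\<close> in both terms.\<close>
    have "Complex t (-1) * \<beta> - Complex t 1 * \<gamma> = - (4 * \<i> * t) * b"
      by (simp add: \<beta>_def \<gamma>_def complex_eq_iff algebra_simps)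
    then have "4 * t * cmod b = cmod (Complex t (-1) * \<beta> - Complex t 1 * \<gamma>)"
      using t by (simp add: norm_mult)
    also have "\<dots> \<le> cmod (Complex t (-1)) * cmod \<beta> + cmod (Complex t 1) * cmod \<gamma>"
      by (metis norm_mult norm_triangle_ineq4)
    also have "\<dots> = sqrt (1 + t\<^sup>2) * (cmod \<beta> + cmod \<gamma>)"
      by (simp add: cmod_def algebra_simps)
    finally have "4 * t * cmod b \<le> sqrt (1 + t\<^sup>2) * (cmod \<beta> + cmod \<gamma>)" .
    then have "(4 * t * cmod b)\<^sup>2 \<le> (sqrt (1 + t\<^sup>2) * (cmod \<beta> + cmod \<gamma>))\<^sup>2"
      using t by (intro power_mono) auto
    then have b: "(4 * t)\<^sup>2 * (cmod b)\<^sup>2 \<le> (1 + t\<^sup>2) * (cmod \<beta> + cmod \<gamma>)\<^sup>2"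
      by (simp add: power_mult_distrib)
    \<comment> \<open>Arithmetic-geometric mean for \<open>e z * g w\<close> and
      \<open>g z * e w\<close>. It bounds the squared sum of the moduli by a multiple of
      \<open>(e z + g z) * (e w + g w)\<close>, so that no constant is lost.\<close>
    have "cmod \<beta> * cmod \<gamma> \<le> 2 * (e z * g w + g z * e w)"
    proof (rule power2_le_imp_le)
      have "(cmod \<beta> * cmod \<gamma>)\<^sup>2 \<le> (4 * e z * e w) * (4 * g z * g w)"
        unfolding power_mult_distrib by (rule mult_mono[OF \<beta> \<gamma>]) (use pos_eg z w in auto)
      also have "\<dots> = (2 * (e z * g w + g z * e w))\<^sup>2 - (2 * (e z * g w - g z * e w))\<^sup>2"
        by (simp add: power2_eq_square algebra_simps)
      also have "\<dots> \<le> (2 * (e z * g w + g z * e w))\<^sup>2" by simp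
      finally show "(cmod \<beta> * cmod \<gamma>)\<^sup>2 \<le> (2 * (e z * g w + g z * e w))\<^sup>2" .
    qed (use pos_eg z w in auto)
    then have "(cmod \<beta> + cmod \<gamma>)\<^sup>2 \<le> 4 * ((e z + g z) * (e w + g w))"
      using \<beta> \<gamma> by (simp add: power2_sum algebra_simps)
    also have "\<dots> = (4 * t)\<^sup>2 * (Re (qform A z) * Re (qform A w))"
      unfolding eg by (simp add: power2_eq_square)
    finally have "(1 + t\<^sup>2) * (cmod \<beta> + cmod \<gamma>)\<^sup>2
        \<le> (1 + t\<^sup>2) * ((4 * t)\<^sup>2 * (Re (qform A z) * Re (qform A w)))"
      by (intro mult_left_mono) auto
    with b have "(4 * t)\<^sup>2 * (cmod b)\<^sup>2 \<le> (4 * t)\<^sup>2 * ((1 + t\<^sup>2) * Re (qform A z) * Re (qform A w))"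
      by (simp add: mult_ac)
    then have "(cmod b)\<^sup>2 \<le> (1 + t\<^sup>2) * Re (qform A z) * Re (qform A w)"
      by (rule mult_left_le_imp_le) (use t in simp)
    then show ?thesis by (simp add: b_def)
  qed
qed

text \<open>Sectorial Cauchy-Schwarz with \<open>w = A z\<close> bounds the square of
  \<open><Az, Az>\<close>; the hypothesis \<open>le\<close> at \<open>A z\<close> produces a factor
  \<open><Az, Az>\<close> on the right, which cancels. For \<open>t = tan \<alpha>\<close> the
  constant \<open>1 + t\<^sup>2\<close> is the square of the secant.\<close>

lemma norm_mult_vec_sectorial:
  assumes A: "A \<in> carrier_mat n n" and t: "0 \<le> t"
    and sec: "\<And>v. v \<in> carrier_vec n \<Longrightarrow> \<bar>Im (qform A v)\<bar> \<le> t * Re (qform A v)"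
    and pos: "\<And>v. v \<in> carrier_vec n \<Longrightarrow> 0 \<le> Re (qform A v)"
    and le: "\<And>v. v \<in> carrier_vec n \<Longrightarrow> Re (qform A v) \<le> c * Re (v \<bullet>c v)"
    and c: "0 \<le> c" and z: "z \<in> carrier_vec n"
  shows "Re ((A *\<^sub>v z) \<bullet>c (A *\<^sub>v z)) \<le> (1 + t\<^sup>2) * c * Re (qform A z)"
proof -
  define p where "p = Re ((A *\<^sub>v z) \<bullet>c (A *\<^sub>v z))"
  have Az: "A *\<^sub>v z \<in> carrier_vec n" using A z by simp
  have p: "0 \<le> p" unfolding p_def by (rule cscalar_self)
  have nn: "0 \<le> (1 + t\<^sup>2) * Re (qform A z)" using pos[OF z] by simp
  have "p\<^sup>2 = (cmod ((A *\<^sub>v z) \<bullet>c (A *\<^sub>v z)))\<^sup>2"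
    using p by (subst cscalar_self(1)) (simp add: p_def)
  also have "\<dots> \<le> (1 + t\<^sup>2) * Re (qform A z) * Re (qform A (A *\<^sub>v z))"
    by (rule sectorial_cauchy_schwarz[OF A t sec pos z Az])
  also have "\<dots> \<le> (1 + t\<^sup>2) * Re (qform A z) * (c * p)"
    unfolding p_def by (rule mult_left_mono[OF le[OF Az] nn])
  finally have "p * p \<le> p * ((1 + t\<^sup>2) * c * Re (qform A z))"
    by (simp add: power2_eq_square mult_ac)
  then show ?thesis
    using p nn c mult_left_le_imp_le[of p p] unfolding p_def[symmetric]
    by (cases "p = 0") (auto simp: mult_ac)
qed

section \<open>Bounds for the resolvent kernel\<close>

text \<open>A one-sided inverse of a square matrix is two-sided, so \<open>A\<close> is a unit of
  the matrix ring and \<open>mat_inverse\<close> cannot return \<open>None\<close>.\<close>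

lemma mat_inv_eqI:
  assumes A: "A \<in> carrier_mat n n" and R: "R \<in> carrier_mat n n" and AR: "A * R = 1\<^sub>m n"
  shows "mat_inv A = R"
proof -
  have RA: "R * A = 1\<^sub>m n" by (rule mat_mult_left_right_inverse[OF A R AR])
  have "A \<in> Units (ring_mat TYPE(complex) n ())"
    using A R AR RA by (auto simp: Units_def ring_mat_def)
  then obtain B where B: "mat_inverse A = Some B"
    using mat_inverse(1)[OF A, of "()"] by (cases "mat_inverse A") auto
  then have BA: "B * A = 1\<^sub>m n" "B \<in> carrier_mat n n" using mat_inverse(2)[OF A] by auto
  have "B = B * (A * R)" using AR BA by simp
  also have "\<dots> = R" using A R BA by (simp add: assoc_mult_mat[of _ n n _ n _ n, symmetric])
  finally show ?thesis by (simp add: mat_inv_def B)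
qed

text \<open>The cofactor formula shows how the inverse depends on the entries, which elimination
  hides. Continuity of the kernel in \<open>s\<close> rests on it.\<close>

lemma mat_inv_adj:
  assumes A: "A \<in> carrier_mat n n" and det: "det A \<noteq> 0"
  shows "mat_inv A = (1 / det A) \<cdot>\<^sub>m adj_mat A"
proof (rule mat_inv_eqI[OF A])
  show "A * ((1 / det A) \<cdot>\<^sub>m adj_mat A) = 1\<^sub>m n"
    using adj_mat[OF A] A det by (auto simp: mult_smult_distrib[of _ n n _ n])
qed (use adj_mat[OF A] in auto)

lemma mat_inv:
  assumes A: "A \<in> carrier_mat n n" and det: "det A \<noteq> 0"
  shows "mat_inv A \<in> carrier_mat n n" "A * mat_inv A = 1\<^sub>m n" "mat_inv A * A = 1\<^sub>m n"
proof -
  show c: "mat_inv A \<in> carrier_mat n n" using adj_mat[OF A] by (simp add: mat_inv_adj[OF A det])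
  show "A * mat_inv A = 1\<^sub>m n"
    using adj_mat[OF A] A det by (auto simp: mat_inv_adj[OF A det] mult_smult_distrib[of _ n n _ n])
  then show "mat_inv A * A = 1\<^sub>m n" by (rule mat_mult_left_right_inverse[OF A c])
qed

lemma det_nonzero_if_qform_pos:
  assumes A: "A \<in> carrier_mat n n"
    and pos: "\<And>v. v \<in> carrier_vec n \<Longrightarrow> v \<noteq> 0\<^sub>v n \<Longrightarrow> 0 < Re (qform A v)"
  shows "det A \<noteq> 0"
proof
  assume "det A = 0"
  then obtain v where v: "v \<in> carrier_vec n" "v \<noteq> 0\<^sub>v n" "A *\<^sub>v v = 0\<^sub>v n"
    using det_0_iff_vec_prod_zero[OF A] by auto
  then have "qform A v = 0" by (simp add: qform_def)
  then show False using pos[OF v(1,2)] by simp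
qed

section \<open>The pencil and the resolvent kernel\<close>

text \<open>This is \<open>(1-s) I + s A^{-1}\<close> multiplied by \<open>A\<close>. It clears the
  inner inverse and is affine in \<open>s\<close>, and the kernel becomes
  \<open>A * mat_inv (pencil A s)\<close>.\<close>

definition pencil :: "complex mat \<Rightarrow> real \<Rightarrow> complex mat" where
  "pencil A s = complex_of_real (1 - s) \<cdot>\<^sub>m A + complex_of_real s \<cdot>\<^sub>m 1\<^sub>m (dim_row A)"

lemma pencil_carrier: "A \<in> carrier_mat n n \<Longrightarrow> pencil A s \<in> carrier_mat n n"
  by (simp add: pencil_def)

lemma pencil_mult_vec:
  assumes "A \<in> carrier_mat n n" "z \<in> carrier_vec n"
  shows "pencil A s *\<^sub>v z = complex_of_real (1 - s) \<cdot>\<^sub>v (A *\<^sub>v z) + complex_of_real s \<cdot>\<^sub>v z"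
  using assms
  by (simp add: pencil_def add_mult_distrib_mat_vec[of _ n n] smult_mat_mult_vec[of _ n])

lemma qform_pencil:
  assumes "A \<in> carrier_mat n n" "z \<in> carrier_vec n"
  shows "qform (pencil A s) z = complex_of_real (1 - s) * qform A z + complex_of_real s * (z \<bullet>c z)"
  using assms
  by (simp add: qform_def pencil_mult_vec[of _ n] cscalar_add_left[of _ n] cscalar_smult_left[of _ n])

lemma qform_pencil_pos:
  assumes A: "A \<in> carrier_mat n n" "accretive A" and s: "s \<in> {0..1}"
    and z: "z \<in> carrier_vec n" "z \<noteq> 0\<^sub>v n"
  shows "0 < Re (qform (pencil A s) z)"
proof -
  have "0 < Re (qform A z)" "0 < Re (z \<bullet>c z)"
    using accretive_qform_pos[OF A z] cscalar_self_pos[OF z] by auto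
  then have "0 < (1 - s) * Re (qform A z) + s * Re (z \<bullet>c z)"
    using s by (cases "s = 0") (auto intro!: add_nonneg_pos)
  then show ?thesis by (simp add: qform_pencil[OF A(1) z(1)])
qed

lemma det_pencil_nonzero:
  assumes "A \<in> carrier_mat n n" "accretive A" "s \<in> {0..1}"
  shows "det (pencil A s) \<noteq> 0"
  using det_nonzero_if_qform_pos[OF pencil_carrier[OF assms(1)]] qform_pencil_pos[OF assms] by blast

lemma resolvent_kernel_eq:
  assumes A: "A \<in> carrier_mat n n" "accretive A" and s: "s \<in> {0..1}"
  shows "resolvent_kernel A s = A * mat_inv (pencil A s)"
  unfolding resolvent_kernel_def
proof (rule mat_inv_eqI)
  have dA: "det A \<noteq> 0" using det_nonzero_if_qform_pos[OF A(1)] accretive_qform_pos[OF A] by blast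
  note iA = mat_inv[OF A(1) dA]
  note iP = mat_inv[OF pencil_carrier[OF A(1)] det_pencil_nonzero[OF A s]]
  have P: "pencil A s \<in> carrier_mat n n" by (rule pencil_carrier[OF A(1)])
  have dim: "dim_row A = n" using A by simp
  let ?M = "complex_of_real (1 - s) \<cdot>\<^sub>m 1\<^sub>m (dim_row A) + complex_of_real s \<cdot>\<^sub>m mat_inv A"
  show M: "?M \<in> carrier_mat n n" using A iA by simp
  show "A * mat_inv (pencil A s) \<in> carrier_mat n n" using A iP by simp
  have "?M * A = pencil A s"
    using A iA unfolding pencil_def dim
    by (simp add: add_mult_distrib_mat[of _ n n _ _ n] mult_smult_assoc_mat[of _ n n _ n])
  then show "?M * (A * mat_inv (pencil A s)) = 1\<^sub>m n"
    using assoc_mult_mat[OF M A(1) iP(1)] iP(2) by simp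
qed

lemma resolvent_kernel_carrier:
  assumes "A \<in> carrier_mat n n" "accretive A" "s \<in> {0..1}"
  shows "resolvent_kernel A s \<in> carrier_mat n n"
  using assms mat_inv(1)[OF pencil_carrier[OF assms(1)] det_pencil_nonzero[OF assms]]
  by (simp add: resolvent_kernel_eq[of _ n])

text \<open>The substitution \<open>x = pencil A s *\<^sub>v z\<close> removes every inverse: later
  estimates involve only \<open>z\<close> and \<open>A z\<close>.\<close>

lemma resolvent_kernel_mult_vec:
  assumes A: "A \<in> carrier_mat n n" "accretive A" and s: "s \<in> {0..1}" and x: "x \<in> carrier_vec n"
  obtains z where "z \<in> carrier_vec n"
    "x = complex_of_real (1 - s) \<cdot>\<^sub>v (A *\<^sub>v z) + complex_of_real s \<cdot>\<^sub>v z"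
    "resolvent_kernel A s *\<^sub>v x = A *\<^sub>v z"
proof
  note P = pencil_carrier[OF A(1), of s]
  note iP = mat_inv[OF P det_pencil_nonzero[OF A s]]
  let ?z = "mat_inv (pencil A s) *\<^sub>v x"
  show z: "?z \<in> carrier_vec n" using iP x by simp
  have "pencil A s *\<^sub>v ?z = x" using assoc_mult_mat_vec[OF P iP(1) x] iP(2) x by simp
  then show "x = complex_of_real (1 - s) \<cdot>\<^sub>v (A *\<^sub>v ?z) + complex_of_real s \<cdot>\<^sub>v ?z"
    using pencil_mult_vec[OF A(1) z] by simp
  show "resolvent_kernel A s *\<^sub>v x = A *\<^sub>v ?z"
    using A iP x s by (simp add: resolvent_kernel_eq[of _ n] assoc_mult_mat_vec[of _ n n _ n])
qed

lemma qform_resolvent_kernel: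
  assumes A: "A \<in> carrier_mat n n" and z: "z \<in> carrier_vec n"
    and x: "x = complex_of_real (1 - s) \<cdot>\<^sub>v (A *\<^sub>v z) + complex_of_real s \<cdot>\<^sub>v z"
    and K: "resolvent_kernel A s *\<^sub>v x = A *\<^sub>v z"
  shows "qform (resolvent_kernel A s) x
    = complex_of_real (1 - s) * ((A *\<^sub>v z) \<bullet>c (A *\<^sub>v z)) + complex_of_real s * qform A z"
proof -
  have "qform (resolvent_kernel A s) x = (A *\<^sub>v z) \<bullet>c x" by (simp add: qform_def K)
  then show ?thesis
    using A z by (simp add: x qform_def cscalar_add_right[of _ n] cscalar_smult_right[of _ n])
qed

section \<open>The scalar kernel and bounds for the matrix kernel\<close>

text \<open>For \<open>c > 0\<close> this is the integrand
  \<open>inverse ((1 - s) + s * inverse c)\<close> of \<open>represents\<close> with the inner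
  fraction cleared.\<close>

definition resolvent_fun :: "real \<Rightarrow> real \<Rightarrow> real" where
  "resolvent_fun s c = c / ((1 - s) * c + s)"

lemma resolvent_fun_denom_pos:
  fixes s c :: real
  assumes "s \<in> {0..1}" "0 < c"
  shows "0 < (1 - s) * c + s"
  using assms by (cases "s = 0") (auto intro!: add_nonneg_pos)

text \<open>Split the numerator \<open>a + b\<close>; replacing \<open>a + b\<close> by one summand
  in the denominator only shrinks it, as \<open>1 - s\<close> is nonnegative.\<close>

lemma resolvent_fun_add_le:
  assumes s: "s \<in> {0..1}" and a: "0 < a" and b: "0 < b"
  shows "resolvent_fun s (a + b) \<le> resolvent_fun s a + resolvent_fun s b"
proof -
  have ab: "0 < (1 - s) * (a + b) + s" using a b by (intro resolvent_fun_denom_pos[OF s]) simp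
  have le: "(1 - s) * a + s \<le> (1 - s) * (a + b) + s" "(1 - s) * b + s \<le> (1 - s) * (a + b) + s"
    using s a b by (auto intro!: mult_left_mono)
  have "a / ((1 - s) * (a + b) + s) \<le> a / ((1 - s) * a + s)"
    using a le(1) ab resolvent_fun_denom_pos[OF s a] by (intro divide_left_mono mult_pos_pos) auto
  moreover have "b / ((1 - s) * (a + b) + s) \<le> b / ((1 - s) * b + s)"
    using b le(2) ab resolvent_fun_denom_pos[OF s b] by (intro divide_left_mono mult_pos_pos) auto
  ultimately show ?thesis by (simp add: resolvent_fun_def add_divide_distrib)
qed

lemma cmod_le_sec_Re:
  assumes \<alpha>: "0 \<le> \<alpha>" "\<alpha> < pi / 2" and z: "\<bar>Im z\<bar> \<le> tan \<alpha> * Re z" and "0 \<le> Re z"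
  shows "cmod z \<le> (1 / cos \<alpha>) * Re z"
proof (rule power2_le_imp_le)
  have cos: "0 < cos \<alpha>" using \<alpha> by (intro cos_gt_zero_pi) auto
  have "(Im z)\<^sup>2 \<le> (tan \<alpha> * Re z)\<^sup>2" using power_mono[OF z, of 2] by simp
  then have "(cmod z)\<^sup>2 \<le> (1 + (tan \<alpha>)\<^sup>2) * (Re z)\<^sup>2"
    by (simp add: cmod_power2 power_mult_distrib algebra_simps)
  also have "\<dots> = (1 / cos \<alpha> * Re z)\<^sup>2"
    using cos tan_sec[of \<alpha>] by (simp add: power_mult_distrib power_divide power_inverse inverse_eq_divide)
  finally show "(cmod z)\<^sup>2 \<le> (1 / cos \<alpha> * Re z)\<^sup>2" .
  show "0 \<le> 1 / cos \<alpha> * Re z" using cos assms by simp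
qed

text \<open>In terms of \<open>p = <Az, Az>\<close>, \<open>q = Re <Az, z>\<close> and
  \<open>r = <z, z>\<close>, the real part of the form is \<open>u p + s q\<close> and the unit norm
  of \<open>x\<close> reads \<open>u^2 p + 2 u s q + s^2 r = 1\<close>. The claim then follows from
  \<open>p <= k c q\<close> and \<open>q <= c r\<close>, where \<open>k\<close> is the squared
  secant.\<close>

lemma qform_resolvent_kernel_upper:
  assumes A: "A \<in> carrier_mat n n" "accretive A" and \<alpha>: "0 \<le> \<alpha>" "\<alpha> < pi / 2"
    and sec: "sectorial \<alpha> A" and c: "0 < c"
    and le: "\<And>v. v \<in> carrier_vec n \<Longrightarrow> Re (qform A v) \<le> c * Re (v \<bullet>c v)"
    and s: "s \<in> {0..1}" and x: "x \<in> carrier_vec n" "x \<bullet>c x = 1"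
  shows "cmod (qform (resolvent_kernel A s) x) \<le> (1 / cos \<alpha>) ^ 3 * resolvent_fun s c"
proof -
  obtain z where z: "z \<in> carrier_vec n"
    and xz: "x = complex_of_real (1 - s) \<cdot>\<^sub>v (A *\<^sub>v z) + complex_of_real s \<cdot>\<^sub>v z"
    and K: "resolvent_kernel A s *\<^sub>v x = A *\<^sub>v z"
    using resolvent_kernel_mult_vec[OF A s x(1)] by blast
  have pos: "0 \<le> Re (qform A v)" if "v \<in> carrier_vec n" for v
    using accretive_qform_pos[OF A that] A(1) by (cases "v = 0\<^sub>v n") (auto simp: qform_def)
  note sect = sectorial_qform[OF A(1) sec]
  have cos: "0 < cos \<alpha>" using \<alpha> by (intro cos_gt_zero_pi) auto
  have t: "0 \<le> tan \<alpha>" using \<alpha> by (cases "\<alpha> = 0") (auto intro!: less_imp_le tan_gt_zero)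
  define p where "p = Re ((A *\<^sub>v z) \<bullet>c (A *\<^sub>v z))"
  define q where "q = Re (qform A z)"
  define r where "r = Re (z \<bullet>c z)"
  define k where "k = 1 + (tan \<alpha>)\<^sup>2"
  define u where "u = 1 - s"
  have us: "0 \<le> u" "0 \<le> s" using s by (auto simp: u_def)
  have k: "k = (1 / cos \<alpha>)\<^sup>2"
    using cos tan_sec[of \<alpha>] by (simp add: k_def power_divide power_inverse inverse_eq_divide)
  have k1: "1 \<le> k" by (simp add: k_def)
  have p: "p \<le> k * c * q" unfolding p_def q_def k_def
    by (rule norm_mult_vec_sectorial[OF A(1) t sect pos le less_imp_le[OF c] z])
  have p0: "0 \<le> p" unfolding p_def by (rule cscalar_self)
  have q: "0 \<le> q" "q \<le> c * r" using pos[OF z] le[OF z] by (auto simp: q_def r_def)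
  have Q: "qform (resolvent_kernel A s) x
      = complex_of_real u * ((A *\<^sub>v z) \<bullet>c (A *\<^sub>v z)) + complex_of_real s * qform A z"
    unfolding u_def by (rule qform_resolvent_kernel[OF A(1) z xz K])
  have ReQ: "Re (qform (resolvent_kernel A s) x) = u * p + s * q" by (simp add: Q p_def q_def)
  have Re0: "0 \<le> u * p + s * q" using us p0 q by simp
  have Im0: "Im ((A *\<^sub>v z) \<bullet>c (A *\<^sub>v z)) = 0" by (subst cscalar_self(1)) (rule Im_complex_of_real)
  \<comment> \<open>Since \<open><Az, Az>\<close> is real, only the second term has an imaginary
    part, and adding a nonnegative real number does not leave the sector.\<close>
  have "\<bar>Im (qform (resolvent_kernel A s) x)\<bar> = s * \<bar>Im (qform A z)\<bar>"
    using us by (simp add: Q Im0 abs_mult)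
  also have "\<dots> \<le> s * (tan \<alpha> * q)" unfolding q_def by (intro mult_left_mono sect z us)
  also have "\<dots> \<le> tan \<alpha> * (u * p + s * q)"
    using t us p0 by (simp add: algebra_simps)
  finally have "cmod (qform (resolvent_kernel A s) x) \<le> 1 / cos \<alpha> * (u * p + s * q)"
    using cmod_le_sec_Re[OF \<alpha>, of "qform (resolvent_kernel A s) x"] Re0 by (simp add: ReQ)
  moreover have "u * p + s * q \<le> k * resolvent_fun s c"
  proof -
    have comm: "z \<bullet>c (A *\<^sub>v z) = cnj (qform A z)"
      using A z unfolding qform_def by (intro cscalar_commute[of _ n]) auto
    have xx: "x \<bullet>c x = complex_of_real (u\<^sup>2) * ((A *\<^sub>v z) \<bullet>c (A *\<^sub>v z))
        + complex_of_real (u * s) * (qform A z + cnj (qform A z)) + complex_of_real (s\<^sup>2) * (z \<bullet>c z)"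
      using A z unfolding xz u_def[symmetric] comm[symmetric]
      by (simp add: cscalar_add_left[of _ n] cscalar_add_right[of _ n] cscalar_smult_left[of _ n]
          cscalar_smult_right[of _ n] qform_def power2_eq_square algebra_simps)
    have norm: "u\<^sup>2 * p + u * s * (2 * q) + s\<^sup>2 * r = 1"
      using arg_cong[OF xx, of Re] unfolding x(2)
      by (simp add: p_def q_def r_def del: of_real_power of_real_mult)
    have "q * 1 \<le> q * k" using q k1 by (intro mult_left_mono) auto
    then have kq: "c * q \<le> k * c * q" using c by (simp add: mult_ac)
    have kr: "q \<le> k * c * r"
      using mult_mono[of 1 k q "c * r"] q k1 by (simp add: mult_ac)
    have kcp: "1 * (c * p) \<le> k * (c * p)" using p0 c k1 by (intro mult_right_mono) auto
    \<comment> \<open>After multiplication by the denominator, the coefficients of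
      \<open>u^2\<close>, \<open>u s\<close> and \<open>s^2\<close> are compared separately with
      those of \<open>k c\<close> times the norm identity; \<open>k >= 1\<close> absorbs the
      slack.\<close>
    have "(u * p + s * q) * (u * c + s) = u\<^sup>2 * (c * p) + u * s * (p + c * q) + s\<^sup>2 * q"
      by (simp add: algebra_simps power2_eq_square)
    also have "\<dots> \<le> u\<^sup>2 * (k * c * p) + u * s * (2 * (k * c * q)) + s\<^sup>2 * (k * c * r)"
    proof (intro add_mono)
      show "u\<^sup>2 * (c * p) \<le> u\<^sup>2 * (k * c * p)" using kcp by (intro mult_left_mono) (auto simp: mult_ac)
      show "u * s * (p + c * q) \<le> u * s * (2 * (k * c * q))"
        using us kq p by (intro mult_left_mono) auto
      show "s\<^sup>2 * q \<le> s\<^sup>2 * (k * c * r)" using kr by (intro mult_left_mono) auto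
    qed
    also have "\<dots> = k * c * (u\<^sup>2 * p + u * s * (2 * q) + s\<^sup>2 * r)" by (simp add: algebra_simps)
    also have "\<dots> = k * c" by (simp add: norm)
    finally have "u * p + s * q \<le> k * c / (u * c + s)"
      using resolvent_fun_denom_pos[OF s c] by (simp only: u_def pos_le_divide_eq)
    then show ?thesis by (simp add: resolvent_fun_def u_def)
  qed
  then have "1 / cos \<alpha> * (u * p + s * q) \<le> 1 / cos \<alpha> * (k * resolvent_fun s c)"
    using cos by (intro mult_left_mono) auto
  moreover have "1 / cos \<alpha> * (k * resolvent_fun s c) = (1 / cos \<alpha>) ^ 3 * resolvent_fun s c"
    by (simp add: k power3_eq_cube power2_eq_square)
  ultimately show ?thesis by linarith
qed

text \<open>A maximizer \<open>x\<close> of \<open>Re \<langle>A x, x\<rangle>\<close> on the unit sphere is an eigenvector of \<open>Re A\<close>,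
  because \<open>c - Re A\<close> is positive semidefinite and its form vanishes at \<open>x\<close>.\<close>

lemma mat_Re_top_eigenvector:
  assumes A: "A \<in> carrier_mat n n" "accretive A" and n: "n \<ge> 1"
  obtains c x where "0 < c" "x \<in> carrier_vec n" "x \<bullet>c x = 1"
    "\<And>v. v \<in> carrier_vec n \<Longrightarrow> Re (qform A v) \<le> c * Re (v \<bullet>c v)"
    "\<And>w. w \<in> carrier_vec n \<Longrightarrow> (A *\<^sub>v x) \<bullet>c w + cnj ((A *\<^sub>v w) \<bullet>c x) = complex_of_real (2 * c) * (x \<bullet>c w)"
proof -
  have R: "mat_Re A \<in> carrier_mat n n" by (rule mat_Re_carrier[OF A(1)])
  \<comment> \<open>The form of \<open>mat_Re A\<close> is real, with value
    \<open>Re <Av, v>\<close> at \<open>v\<close>. As its value \<open>c\<close> at the maximizer is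
    positive, maximal modulus means maximal value.\<close>
  obtain z where z: "z \<in> num_range (mat_Re A)" "\<forall>z' \<in> num_range (mat_Re A). cmod z' \<le> cmod z"
    using num_radius_attained[OF R n] by blast
  then obtain x where x: "x \<in> carrier_vec n" "x \<bullet>c x = 1" "z = qform (mat_Re A) x"
    using R by (auto simp: num_range_def)
  define c where "c = Re (qform A x)"
  have "x \<noteq> 0\<^sub>v n" using x by auto
  then have c: "0 < c" using accretive_qform_pos[OF A x(1)] by (simp add: c_def)
  have unit: "Re (qform A u) \<le> c" if u: "u \<in> carrier_vec n" "u \<bullet>c u = 1" for u
  proof -
    have "qform (mat_Re A) u \<in> num_range (mat_Re A)" using u R by (auto simp: num_range_def)
    then have "\<bar>Re (qform A u)\<bar> \<le> \<bar>c\<bar>"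
      using z(2) x A u by (auto simp: qform_mat_Re[of _ n] c_def)
    then show ?thesis using c by simp
  qed
  have le: "Re (qform A v) \<le> c * Re (v \<bullet>c v)" if "v \<in> carrier_vec n" for v
    by (rule qform_le_by_unit[OF A(1) that unit])
  define E where "E = complex_of_real c \<cdot>\<^sub>m 1\<^sub>m n + (- 1) \<cdot>\<^sub>m A"
  have E: "E \<in> carrier_mat n n" using A by (simp add: E_def)
  have Ev: "E *\<^sub>v v = complex_of_real c \<cdot>\<^sub>v v + (- 1) \<cdot>\<^sub>v (A *\<^sub>v v)" if "v \<in> carrier_vec n" for v
    using A that
    by (simp add: E_def add_mult_distrib_mat_vec[of _ n n] smult_mat_mult_vec[of _ n])
  have Evw: "(E *\<^sub>v v) \<bullet>c w = c * (v \<bullet>c w) - (A *\<^sub>v v) \<bullet>c w"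
    if "v \<in> carrier_vec n" "w \<in> carrier_vec n" for v w
    using A that by (simp add: Ev cscalar_add_left[of _ n] cscalar_smult_left[of _ n])
  have qE: "Re (qform E v) = c * Re (v \<bullet>c v) - Re (qform A v)" if "v \<in> carrier_vec n" for v
    using that by (simp add: qform_def Evw)
  have "(A *\<^sub>v x) \<bullet>c w + cnj ((A *\<^sub>v w) \<bullet>c x) = complex_of_real (2 * c) * (x \<bullet>c w)" if w: "w \<in> carrier_vec n" for w
  proof -
    have "(cmod ((E *\<^sub>v x) \<bullet>c w + cnj ((E *\<^sub>v w) \<bullet>c x)))\<^sup>2 \<le> 4 * Re (qform E x) * Re (qform E w)"
      by (rule qform_cauchy_schwarz[OF E _ x(1) w]) (use qE le in simp)
    then have "(E *\<^sub>v x) \<bullet>c w + cnj ((E *\<^sub>v w) \<bullet>c x) = 0"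
      using qE[OF x(1)] x(2) by (simp add: c_def)
    then show ?thesis
      using x(1) w cscalar_commute[OF x(1) w] by (simp add: Evw algebra_simps)
  qed
  then show thesis by (intro that[OF c x(1,2) le])
qed

text \<open>Let \<open>N\<close> be the pencil and \<open>N z = x\<close>. As \<open>x\<close> is an
  eigenvector of \<open>Re N\<close> with eigenvalue \<open>d = (1-s) c + s\<close>, Cauchy-Schwarz
  for \<open>Re N\<close> yields \<open>Re <z, x> <= 1/d\<close>. Pairing
  \<open>x = (1-s) A z + s z\<close> with \<open>x\<close> turns this upper bound into a lower bound
  for \<open>Re <Az, x>\<close>, which is the real part of the kernel form.\<close>

lemma qform_resolvent_kernel_lower:
  assumes A: "A \<in> carrier_mat n n" "accretive A" and c: "0 < c"
    and x: "x \<in> carrier_vec n" "x \<bullet>c x = 1"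
    and eig: "\<And>w. w \<in> carrier_vec n \<Longrightarrow>
      (A *\<^sub>v x) \<bullet>c w + cnj ((A *\<^sub>v w) \<bullet>c x) = complex_of_real (2 * c) * (x \<bullet>c w)"
    and s: "s \<in> {0..1}"
  shows "resolvent_fun s c \<le> Re (qform (resolvent_kernel A s) x)"
proof -
  obtain z where z: "z \<in> carrier_vec n"
    and xz: "x = complex_of_real (1 - s) \<cdot>\<^sub>v (A *\<^sub>v z) + complex_of_real s \<cdot>\<^sub>v z"
    and K: "resolvent_kernel A s *\<^sub>v x = A *\<^sub>v z"
    using resolvent_kernel_mult_vec[OF A s x(1)] by blast
  let ?N = "pencil A s"
  have N: "?N \<in> carrier_mat n n" by (rule pencil_carrier[OF A(1)])
  have Nz: "?N *\<^sub>v z = x" using pencil_mult_vec[OF A(1) z] xz by simp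
  define d where "d = (1 - s) * c + s"
  have d: "0 < d" unfolding d_def by (rule resolvent_fun_denom_pos[OF s c])
  define g where "g = Re (z \<bullet>c x)"
  have Az: "A *\<^sub>v z \<in> carrier_vec n" "A *\<^sub>v x \<in> carrier_vec n" using A z x by auto
  have qx: "Re (qform A x) = c" using arg_cong[OF eig[OF x(1)], of Re] x(2) by (simp add: qform_def)
  have pos: "0 \<le> Re (qform ?N v)" if "v \<in> carrier_vec n" for v
    using qform_pencil_pos[OF A s that] N by (cases "v = 0\<^sub>v n") (auto simp: qform_def)
  have zx: "z \<bullet>c x = cnj (x \<bullet>c z)" by (rule cscalar_commute[OF x(1) z])
  have "(?N *\<^sub>v x) \<bullet>c z + cnj ((?N *\<^sub>v z) \<bullet>c x)
      = complex_of_real (1 - s) * ((A *\<^sub>v x) \<bullet>c z + cnj ((A *\<^sub>v z) \<bullet>c x))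
        + complex_of_real s * (x \<bullet>c z + cnj (z \<bullet>c x))"
    using A x z Az
    by (simp add: pencil_mult_vec[of _ n] cscalar_add_left[of _ n] cscalar_smult_left[of _ n] algebra_simps)
  also have "\<dots> = 2 * d * (x \<bullet>c z)"
    unfolding eig[OF z] zx by (simp add: d_def algebra_simps)
  finally have form: "(?N *\<^sub>v x) \<bullet>c z + cnj ((?N *\<^sub>v z) \<bullet>c x) = 2 * d * (x \<bullet>c z)" .
  have qN: "Re (qform ?N x) = d" "Re (qform ?N z) = g"
    using qx x(2) zx by (simp_all add: qform_pencil[OF A(1) x(1)] d_def) (simp add: qform_def Nz g_def)
  have "(cmod (2 * d * (x \<bullet>c z)))\<^sup>2 \<le> 4 * d * g"
    using qform_cauchy_schwarz[OF N pos x(1) z] unfolding form qN .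
  then have "d * (d * (cmod (x \<bullet>c z))\<^sup>2) \<le> d * g"
    using d by (simp add: norm_mult power_mult_distrib power2_eq_square mult_ac)
  then have "d * (cmod (x \<bullet>c z))\<^sup>2 \<le> g" using d by simp
  moreover have "g\<^sup>2 \<le> (cmod (x \<bullet>c z))\<^sup>2"
    unfolding g_def zx by (simp add: cmod_power2)
  ultimately have "d * g\<^sup>2 \<le> g" using mult_left_mono[of "g\<^sup>2" "(cmod (x \<bullet>c z))\<^sup>2" d] d by linarith
  \<comment> \<open>A nonpositive \<open>g\<close> is trivial; otherwise one factor \<open>g\<close>
    cancels.\<close>
  then have dg: "d * g \<le> 1"
    using d by (cases "g \<le> 0") (auto simp: power2_eq_square mult_le_0_iff intro: order_trans[of _ 0])
  have Q: "Re (qform (resolvent_kernel A s) x) = Re ((A *\<^sub>v z) \<bullet>c x)" by (simp add: qform_def K)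
  show ?thesis
  proof (cases "s = 1")
    \<comment> \<open>The main argument divides by \<open>1 - s\<close>. At \<open>s = 1\<close> the
      vector \<open>z\<close> is \<open>x\<close> itself, and the value is
      \<open>Re <Ax, x> = c\<close>.\<close>
    case True
    then have "z = x" using xz A z by auto
    then show ?thesis using qx unfolding Q by (simp add: True resolvent_fun_def qform_def)
  next
    case False
    have "x \<bullet>c x = complex_of_real (1 - s) * ((A *\<^sub>v z) \<bullet>c x) + complex_of_real s * (z \<bullet>c x)"
      by (subst xz) (use x z Az in \<open>simp add: cscalar_add_left[of _ n] cscalar_smult_left[of _ n]\<close>)
    then have one: "1 = (1 - s) * Re ((A *\<^sub>v z) \<bullet>c x) + s * g"
      unfolding x(2) by (simp add: complex_eq_iff g_def)
    have "(1 - s) * c = d - s" by (simp add: d_def)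
    also have "\<dots> \<le> d - s * (d * g)" using dg s by (simp add: mult_left_le)
    also have "\<dots> = d * (1 - s * g)" by (simp add: algebra_simps)
    also have "1 - s * g = (1 - s) * Re ((A *\<^sub>v z) \<bullet>c x)" using one by simp
    finally have "(1 - s) * c \<le> (1 - s) * (d * Re ((A *\<^sub>v z) \<bullet>c x))" by (simp add: mult_ac)
    then have "c \<le> d * Re ((A *\<^sub>v z) \<bullet>c x)" using False s by simp
    then show ?thesis
      using d unfolding Q resolvent_fun_def d_def[symmetric] by (simp add: pos_divide_le_eq mult.commute)
  qed
qed

section \<open>Integration of the resolvent kernel\<close>

text \<open>By the Leibniz formula the determinant is a polynomial in the entries.\<close>

lemma continuous_on_det:
  fixes M :: "'a::topological_space \<Rightarrow> complex mat"
  assumes M: "\<And>s. M s \<in> carrier_mat n n"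
    and cont: "\<And>i j. i < n \<Longrightarrow> j < n \<Longrightarrow> continuous_on S (\<lambda>s. M s $$ (i, j))"
  shows "continuous_on S (\<lambda>s. det (M s))"
proof -
  have "continuous_on S (\<lambda>s. \<Sum>p \<in> {p. p permutes {0..<n}}. signof p * (\<Prod>i = 0..<n. M s $$ (i, p i)))"
    by (intro continuous_intros continuous_on_prod cont) (auto dest: permutes_in_image)
  then show ?thesis unfolding det_def'[OF M] .
qed

text \<open>Entry \<open>(i, j)\<close> of the inverse is the cofactor at \<open>(j, i)\<close> over
  the determinant, hence the swapped indices in \<open>mat_delete\<close>.\<close>

lemma continuous_on_mat_inv:
  fixes M :: "'a::topological_space \<Rightarrow> complex mat"
  assumes M: "\<And>s. M s \<in> carrier_mat n n"
    and cont: "\<And>i j. i < n \<Longrightarrow> j < n \<Longrightarrow> continuous_on S (\<lambda>s. M s $$ (i, j))"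
    and det: "\<And>s. s \<in> S \<Longrightarrow> det (M s) \<noteq> 0" and ij: "i < n" "j < n"
  shows "continuous_on S (\<lambda>s. mat_inv (M s) $$ (i, j))"
proof -
  have dims: "dim_row (M s) = n" "dim_col (M s) = n" for s using M[of s] by auto
  have "continuous_on S (\<lambda>s. det (mat_delete (M s) j i))"
  proof (rule continuous_on_det)
    show "mat_delete (M s) j i \<in> carrier_mat (n - 1) (n - 1)" for s
      by (rule mat_delete_carrier[OF M])
    show "continuous_on S (\<lambda>s. mat_delete (M s) j i $$ (k, l))" if "k < n - 1" "l < n - 1" for k l
      using that ij by (simp add: mat_delete_def dims cont)
  qed
  then have "continuous_on S (\<lambda>s. (1 / det (M s)) * ((- 1) ^ (j + i) * det (mat_delete (M s) j i)))"
    using det by (intro continuous_intros continuous_on_det[OF M cont]) auto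
  moreover have "mat_inv (M s) $$ (i, j) = (1 / det (M s)) * ((- 1) ^ (j + i) * det (mat_delete (M s) j i))"
    if "s \<in> S" for s
    using mat_inv_adj[OF M det[OF that]] ij by (simp add: adj_mat_def cofactor_def dims)
  ultimately show ?thesis by (simp cong: continuous_on_cong)
qed

lemma continuous_on_resolvent_kernel:
  assumes A: "A \<in> carrier_mat n n" "accretive A" and ij: "i < n" "j < n"
  shows "continuous_on {0..1} (\<lambda>s. resolvent_kernel A s $$ (i, j))"
proof -
  have inv: "continuous_on {0..1} (\<lambda>s. mat_inv (pencil A s) $$ (k, l))" if "k < n" "l < n" for k l
  proof (rule continuous_on_mat_inv[OF pencil_carrier[OF A(1)] _ det_pencil_nonzero[OF A] that])
    show "continuous_on {0..1} (\<lambda>s. pencil A s $$ (i, j))" if "i < n" "j < n" for i j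
      using A that by (auto simp: pencil_def intro!: continuous_intros)
  qed
  have "continuous_on {0..1} (\<lambda>s. \<Sum>k<n. A $$ (i, k) * mat_inv (pencil A s) $$ (k, j))"
    using ij by (intro continuous_intros inv) auto
  moreover have "resolvent_kernel A s $$ (i, j) = (\<Sum>k<n. A $$ (i, k) * mat_inv (pencil A s) $$ (k, j))"
    if s: "s \<in> {0..1}" for s
    using A ij mat_inv(1)[OF pencil_carrier[OF A(1)] det_pencil_nonzero[OF A s]]
    by (auto simp: resolvent_kernel_eq[OF A s] scalar_prod_def lessThan_atLeast0)
  ultimately show ?thesis by (subst continuous_on_cong[OF refl])
qed

section \<open>Integrals over the representing measure\<close>

lemma integrable_continuous_unit_interval:
  fixes g :: "real \<Rightarrow> 'a::{banach, second_countable_topology}"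
  assumes \<nu>: "prob_space \<nu>" "sets \<nu> = sets (restrict_space borel {0..1})"
    and g: "continuous_on {0..1} g"
  shows "integrable \<nu> g"
proof -
  interpret prob_space \<nu> by fact
  have sp: "space \<nu> = {0..1}" using sets_eq_imp_space_eq[OF \<nu>(2)] by (simp add: space_restrict_space)
  obtain K where K: "\<And>s. s \<in> {0..1} \<Longrightarrow> norm (g s) \<le> K"
    using compact_imp_bounded[OF compact_continuous_image[OF g compact_Icc]]
    unfolding bounded_iff by blast
  show ?thesis
  proof (rule integrable_const_bound[of _ K])
    show "AE s in \<nu>. norm (g s) \<le> K" using K by (intro AE_I2) (simp add: sp)
    show "g \<in> borel_measurable \<nu>"
      using borel_measurable_continuous_on_restrict[OF g] by (simp cong: measurable_cong_sets add: \<nu>(2))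
  qed
qed

text \<open>Both branches in the definition of the representing measure give a probability measure on
  the unit interval, so no representation theorem is needed.\<close>

lemma rep_measure:
  "prob_space (rep_measure f)" "sets (rep_measure f) = sets (restrict_space borel {0..1})"
proof -
  have "prob_space (rep_measure f) \<and> sets (rep_measure f) = sets (restrict_space borel {0..1})"
  proof (cases "\<exists>\<nu>. represents \<nu> f")
    case True
    then have "represents (rep_measure f) f" unfolding rep_measure_def by (auto intro: someI_ex)
    then show ?thesis by (simp add: represents_def)
  next
    case False
    then show ?thesis
      unfolding rep_measure_def by (auto intro!: prob_space_return simp: space_restrict_space)
  qed
  then show "prob_space (rep_measure f)" "sets (rep_measure f) = sets (restrict_space borel {0..1})"
    by auto
qed

lemma space_rep_measure: "space (rep_measure f) = {0..1}"
  using sets_eq_imp_space_eq[OF rep_measure(2)] by (simp add: space_restrict_space)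

text \<open>The form at a fixed \<open>x\<close> is a finite linear combination of matrix entries,
  so it commutes with the entrywise integral.\<close>

lemma qform_mat_fun:
  assumes A: "A \<in> carrier_mat n n" "accretive A" and x: "x \<in> carrier_vec n"
  shows "integrable (rep_measure f) (\<lambda>s. qform (resolvent_kernel A s) x)" (is ?int)
    and "qform (mat_fun f A) x = (\<integral>s. qform (resolvent_kernel A s) x \<partial>(rep_measure f))" (is ?eq)
proof -
  let ?\<nu> = "rep_measure f"
  have q: "qform M x = (\<Sum>i<n. \<Sum>j<n. M $$ (i, j) * x $ j * cnj (x $ i))"
    if "M \<in> carrier_mat n n" for M
    using that x
    by (auto simp: qform_def scalar_prod_def lessThan_atLeast0 sum_distrib_right intro!: sum.cong)
  have entry: "integrable ?\<nu> (\<lambda>s. resolvent_kernel A s $$ (i, j))" if "i < n" "j < n" for i j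
    by (rule integrable_continuous_unit_interval[OF rep_measure continuous_on_resolvent_kernel[OF A that]])
  have ker: "qform (resolvent_kernel A s) x
      = (\<Sum>i<n. \<Sum>j<n. resolvent_kernel A s $$ (i, j) * x $ j * cnj (x $ i))"
    if "s \<in> space ?\<nu>" for s
    using that by (intro q resolvent_kernel_carrier[OF A]) (simp add: space_rep_measure)
  have "integrable ?\<nu> (\<lambda>s. \<Sum>i<n. \<Sum>j<n. resolvent_kernel A s $$ (i, j) * x $ j * cnj (x $ i))"
    by (intro Bochner_Integration.integrable_sum integrable_mult_left entry) auto
  then show ?int using ker by (simp cong: Bochner_Integration.integrable_cong)
  have F: "mat_fun f A \<in> carrier_mat n n" using A by (simp add: mat_fun_def)
  have "qform (mat_fun f A) x
      = (\<Sum>i<n. \<Sum>j<n. (\<integral>s. resolvent_kernel A s $$ (i, j) \<partial>?\<nu>) * x $ j * cnj (x $ i))"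
    unfolding q[OF F] using A by (auto simp: mat_fun_def intro!: sum.cong)
  also have "\<dots> = (\<Sum>i<n. \<Sum>j<n. \<integral>s. resolvent_kernel A s $$ (i, j) * x $ j * cnj (x $ i) \<partial>?\<nu>)"
    by (intro sum.cong) auto
  also have "\<dots> = (\<Sum>i<n. \<integral>s. (\<Sum>j<n. resolvent_kernel A s $$ (i, j) * x $ j * cnj (x $ i)) \<partial>?\<nu>)"
    by (intro sum.cong refl Bochner_Integration.integral_sum[symmetric] integrable_mult_left entry) auto
  also have "\<dots> = (\<integral>s. (\<Sum>i<n. \<Sum>j<n. resolvent_kernel A s $$ (i, j) * x $ j * cnj (x $ i)) \<partial>?\<nu>)"
    by (intro Bochner_Integration.integral_sum[symmetric] Bochner_Integration.integrable_sum
        integrable_mult_left entry) auto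
  also have "\<dots> = (\<integral>s. qform (resolvent_kernel A s) x \<partial>?\<nu>)"
    by (intro Bochner_Integration.integral_cong refl) (simp add: ker)
  finally show ?eq .
qed

lemma integrable_resolvent_fun:
  assumes "0 < c"
  shows "integrable (rep_measure f) (\<lambda>s. resolvent_fun s c)"
proof (rule integrable_continuous_unit_interval[OF rep_measure])
  show "continuous_on {0..1} (\<lambda>s. resolvent_fun s c)"
    unfolding resolvent_fun_def
    using resolvent_fun_denom_pos[OF _ assms] by (intro continuous_intros) force
qed

text \<open>The same eigenvector \<open>x\<close> serves every \<open>s\<close>, so the pointwise
  lower bounds can be integrated. The constant \<open>c\<close> is returned with its bound on the
  form, so that the constants of \<open>A\<close> and \<open>B\<close> can be added to one for
  \<open>A + B\<close>.\<close>

lemma num_radius_mat_fun_ge: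
  assumes A: "A \<in> carrier_mat n n" "accretive A" and n: "n \<ge> 1"
  obtains c where "0 < c" "\<And>v. v \<in> carrier_vec n \<Longrightarrow> Re (qform A v) \<le> c * Re (v \<bullet>c v)"
    "(\<integral>s. resolvent_fun s c \<partial>(rep_measure f)) \<le> num_radius (mat_fun f A)"
proof -
  obtain c x where c: "0 < c" and x: "x \<in> carrier_vec n" "x \<bullet>c x = 1"
    and le: "\<And>v. v \<in> carrier_vec n \<Longrightarrow> Re (qform A v) \<le> c * Re (v \<bullet>c v)"
    and eig: "\<And>w. w \<in> carrier_vec n \<Longrightarrow>
      (A *\<^sub>v x) \<bullet>c w + cnj ((A *\<^sub>v w) \<bullet>c x) = complex_of_real (2 * c) * (x \<bullet>c w)"
    by (rule mat_Re_top_eigenvector[OF A n]) (rule that; blast)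
  have F: "mat_fun f A \<in> carrier_mat n n" using A by (simp add: mat_fun_def)
  note Q = qform_mat_fun[OF A x(1), of f]
  have "(\<integral>s. resolvent_fun s c \<partial>(rep_measure f))
      \<le> (\<integral>s. Re (qform (resolvent_kernel A s) x) \<partial>(rep_measure f))"
    by (intro integral_mono integrable_resolvent_fun[OF c] integrable_Re Q(1)
        qform_resolvent_kernel_lower[OF A c x eig]) (simp_all add: space_rep_measure)
  also have "\<dots> = Re (qform (mat_fun f A) x)" unfolding Q(2) by (rule integral_Re[OF Q(1)])
  also have "\<dots> \<le> cmod (qform (mat_fun f A) x)" by (rule complex_Re_le_cmod)
  also have "\<dots> \<le> num_radius (mat_fun f A)"
  proof -
    have "qform (mat_fun f A) x \<in> num_range (mat_fun f A)" using F x by (auto simp: num_range_def)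
    then show ?thesis using num_radius_attained[OF F n] by auto
  qed
  finally show thesis by (rule that[OF c, rotated]) (rule le)
qed

text \<open>Here \<open>c\<close> is any positive upper bound of the real part, not necessarily an
  eigenvalue; it will be the sum of the constants for two matrices.\<close>

lemma num_radius_mat_fun_le:
  assumes A: "A \<in> carrier_mat n n" "accretive A" and n: "n \<ge> 1"
    and \<alpha>: "0 \<le> \<alpha>" "\<alpha> < pi / 2" and sec: "sectorial \<alpha> A" and c: "0 < c"
    and le: "\<And>v. v \<in> carrier_vec n \<Longrightarrow> Re (qform A v) \<le> c * Re (v \<bullet>c v)"
  shows "num_radius (mat_fun f A) \<le> (1 / cos \<alpha>) ^ 3 * (\<integral>s. resolvent_fun s c \<partial>(rep_measure f))"
proof -
  have F: "mat_fun f A \<in> carrier_mat n n" using A by (simp add: mat_fun_def)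
  obtain x where x: "x \<in> carrier_vec n" "x \<bullet>c x = 1"
    and w: "num_radius (mat_fun f A) = cmod (qform (mat_fun f A) x)"
    using num_radius_attained[OF F n] F by (auto simp: num_range_def)
  note Q = qform_mat_fun[OF A x(1), of f]
  have "cmod (qform (mat_fun f A) x) \<le> (\<integral>s. cmod (qform (resolvent_kernel A s) x) \<partial>(rep_measure f))"
    unfolding Q(2) by (rule integral_norm_bound)
  also have "\<dots> \<le> (\<integral>s. (1 / cos \<alpha>) ^ 3 * resolvent_fun s c \<partial>(rep_measure f))"
    by (intro integral_mono integrable_norm Q(1) integrable_mult_right integrable_resolvent_fun[OF c]
        qform_resolvent_kernel_upper[OF A \<alpha> sec c le _ x]) (simp_all add: space_rep_measure)
  also have "\<dots> = (1 / cos \<alpha>) ^ 3 * (\<integral>s. resolvent_fun s c \<partial>(rep_measure f))" by simp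
  finally show ?thesis by (simp add: w)
qed

theorem theorem3p5:
  fixes \<alpha> :: real and n :: nat and A B :: "complex mat" and f :: "real \<Rightarrow> real"
  assumes "0 \<le> \<alpha>" and "\<alpha> < pi / 2"
    and "n \<ge> 1"
    and "A \<in> carrier_mat n n" and "B \<in> carrier_mat n n"
    and "accretive A" and "accretive B"
    and "sectorial \<alpha> A" and "sectorial \<alpha> B"
    and "\<And>x. 0 < x \<Longrightarrow> 0 < f x"
    and "operator_monotone f"
    and "f 1 = 1"
  shows "num_radius (mat_fun f (A + B))
    \<le> (1 / cos \<alpha>) ^ 3 * (num_radius (mat_fun f A) + num_radius (mat_fun f B))"
proof -
  note A = assms(4,6) and B = assms(5,7)
  have \<alpha>: "0 \<le> \<alpha>" "\<alpha> < pi / 2" by fact+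
  have cos: "0 < cos \<alpha>" using \<alpha> by (intro cos_gt_zero_pi) auto
  let ?I = "\<lambda>c. \<integral>s. resolvent_fun s c \<partial>(rep_measure f)"
  obtain a where a: "0 < a" "?I a \<le> num_radius (mat_fun f A)"
    and lea: "\<And>v. v \<in> carrier_vec n \<Longrightarrow> Re (qform A v) \<le> a * Re (v \<bullet>c v)"
    using num_radius_mat_fun_ge[OF A \<open>n \<ge> 1\<close>, of f] by metis
  obtain b where b: "0 < b" "?I b \<le> num_radius (mat_fun f B)"
    and leb: "\<And>v. v \<in> carrier_vec n \<Longrightarrow> Re (qform B v) \<le> b * Re (v \<bullet>c v)"
    using num_radius_mat_fun_ge[OF B \<open>n \<ge> 1\<close>, of f] by metis
  have AB: "A + B \<in> carrier_mat n n" using A B by simp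
  have add: "qform (A + B) v = qform A v + qform B v" if "v \<in> carrier_vec n" for v
    by (rule qform_add_mat[OF A(1) B(1) that])
  have "accretive (A + B)"
    by (rule accretiveI[OF AB]) (simp add: add accretive_qform_pos[OF A] accretive_qform_pos[OF B] add_pos_pos)
  \<comment> \<open>The sector is closed under addition, by the triangle inequality for imaginary
    parts.\<close>
  moreover have "sectorial \<alpha> (A + B)"
    using AB sectorial_qform[OF A(1) assms(8)] sectorial_qform[OF B(1) assms(9)]
    by (fastforce simp: sectorial_def num_range_def sector_def add distrib_left
        intro: order_trans[OF abs_triangle_ineq] add_mono)
  moreover have "Re (qform (A + B) v) \<le> (a + b) * Re (v \<bullet>c v)" if "v \<in> carrier_vec n" for v
    using lea[OF that] leb[OF that] by (simp add: add[OF that] distrib_right)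
  ultimately have "num_radius (mat_fun f (A + B)) \<le> (1 / cos \<alpha>) ^ 3 * ?I (a + b)"
    using a b by (intro num_radius_mat_fun_le[OF AB _ \<open>n \<ge> 1\<close> \<alpha>]) auto
  also have "(1 / cos \<alpha>) ^ 3 * ?I (a + b) \<le> (1 / cos \<alpha>) ^ 3 * (num_radius (mat_fun f A) + num_radius (mat_fun f B))"
  proof (rule mult_left_mono)
    \<comment> \<open>Subadditivity holds for each \<open>s\<close>, hence for the
      integrals.\<close>
    have "?I (a + b) \<le> (\<integral>s. resolvent_fun s a + resolvent_fun s b \<partial>(rep_measure f))"
      using a b
      by (intro integral_mono integrable_resolvent_fun Bochner_Integration.integrable_add
        resolvent_fun_add_le) (auto simp: space_rep_measure)
  also have "\<dots> = ?I a + ?I b"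
    by (intro Bochner_Integration.integral_add integrable_resolvent_fun a b)
  also have "\<dots> \<le> num_radius (mat_fun f A) + num_radius (mat_fun f B)"
    using a b by (intro add_mono) auto
    finally show "?I (a + b) \<le> num_radius (mat_fun f A) + num_radius (mat_fun f B)" .
  qed (use cos in simp)
  finally show ?thesis .
qed

end
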